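(* Let $K$ be an algebraically closed field of characteristic zero and let $f\in K[x]$ be such that $t(f)\ge 3$. Then, for all integers $k\ge 2$: 1) $t(f^k)\ge 4$. 2) If $t(f^k)=4$, then $k=2$ and $f\simeq 1+x-\frac12 x^2$.
   Context: For a nonzero $f=\sum_j a_jx^j\in K[x]$, $t(f)$ denotes the number of nonzero coefficients of $f$, i.e. $t(f)=\#\{j\in\mathbb{N}_0: a_j\neq 0\}$. The relation $\simeq$ is the equivalence relation on $K[x]$ generated by: $f\simeq \lambda f$ for all $\lambda\in K^\times$; $f(x)\simeq f(\lambda x)$ for all $\lambda\in K^\times$; $f(x)\simeq f(x^m)$ for all $m\in\mathbb{N}=\{1,2,\dots\}$; and $f(x)\simeq x^n f(1/x)$, where $n=\deg(f)$ (for $f\ne 0$). *)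

theory Defs
  imports "HOL-Computational_Algebra.Polynomial"
begin

definition num_terms :: "'a::zero poly \<Rightarrow> nat" where
  "num_terms f = card {j. coeff f j \<noteq> 0}"

(* In poly_step_reflect, reflect_poly f is x^n f(1/x) with n = degree f
   (see poly_reflect_poly_nz); it also cancels any power of x dividing f. *)
inductive poly_step :: "'a::field poly \<Rightarrow> 'a poly \<Rightarrow> bool" where
  poly_step_smult: "c \<noteq> 0 \<Longrightarrow> poly_step f (smult c f)"
| poly_step_scale: "c \<noteq> 0 \<Longrightarrow> poly_step f (pcompose f [:0, c:])"
| poly_step_power: "m \<ge> 1 \<Longrightarrow> poly_step f (pcompose f (monom 1 m))"
| poly_step_reflect: "f \<noteq> 0 \<Longrightarrow> poly_step f (reflect_poly f)"

definition poly_equiv :: "'a::field poly \<Rightarrow> 'a poly \<Rightarrow> bool"  (infix "\<simeq>" 50) where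
  "f \<simeq> g \<longleftrightarrow> equivclp poly_step f g"

end

theory Submission
  imports Defs
begin

text \<open>
  After division by a power of \<open>x\<close> the polynomial \<open>f\<close> has a nonzero constant term. Let \<open>N\<close> be its
  degree, \<open>p\<close> its least positive exponent, and \<open>N - q\<close> its second largest exponent, so that
  \<open>p + q \<le> N\<close>. The two lowest and the two highest terms of \<open>f ^ k\<close> cannot cancel
  (\<open>coeff_power_second_lowest_nonzero\<close>, \<open>coeff_power_second_highest_nonzero\<close>); they sit at the
  exponents \<open>0 < p < k N - q < k N\<close>, which gives four terms.

  Suppose that there are no others. Below the exponent \<open>k N - q\<close> the power \<open>g = f ^ k\<close> is the
  binomial \<open>g\<^sub>0 + g\<^sub>p x ^ p\<close>, so \<open>f\<close> agrees there with the \<open>k\<close>-th root of a binomial. The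
  binomial series of exponent \<open>1 / k\<close> has no vanishing coefficients and never stops, whereas \<open>f\<close>
  stops at \<open>N\<close>. The differential equation \<open>f g' = k f' g\<close> makes this precise, as a two-term
  recursion that links the coefficients of \<open>f\<close> at \<open>j - p\<close> and \<open>j\<close> for all \<open>j < k N - q\<close>
  (\<open>binomial_root_recursion\<close>).
  At \<open>j = N + p\<close> the recursion would contradict the choice of the degree, so \<open>k N \<le> N + p + q\<close>.
  At \<open>j = N\<close> it shows that \<open>N - p\<close> is an exponent of \<open>f\<close>, so \<open>q \<le> p \<le> N - p\<close>. Together
  these inequalities leave only \<open>k = 2\<close> and \<open>N = 2 p\<close>, and the recursion then yields
  \<open>f = f\<^sub>0 (1 + y - y\<^sup>2 / 2)\<close> with \<open>y\<close> a multiple of \<open>x ^ p\<close>.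
\<close>

section \<open>Coefficients of powers\<close>

text \<open>
  This is \<open>f g' = k f' g\<close> for \<open>g = f ^ k\<close>, multiplied by \<open>x\<close>, so that differentiation
  multiplies the coefficient at \<open>i\<close> by \<open>i\<close> without shifting it.
\<close>

lemma coeff_power_log_derivative:
  fixes f :: "'a::field_char_0 poly"
  shows "(\<Sum>i\<le>j. of_nat i * coeff (f ^ k) i * coeff f (j - i)) =
    of_nat k * (\<Sum>i\<le>j. coeff (f ^ k) i * (of_nat (j - i) * coeff f (j - i)))"
proof (cases k)
  case 0
  then show ?thesis by (auto intro!: sum.neutral simp: coeff_1)
next
  case (Suc n)
  define \<theta> :: "'a poly \<Rightarrow> 'a poly" where "\<theta> h = pCons 0 (pderiv h)" for h
  have coeff_theta: "coeff (\<theta> h) i = of_nat i * coeff h i" for h i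
    by (cases i) (simp_all add: \<theta>_def coeff_pderiv)
  have "\<theta> (f ^ k) * f = smult (of_nat k) (f ^ k * \<theta> f)"
    unfolding \<theta>_def Suc pderiv_power_Suc by (simp add: mult_ac del: of_nat_Suc)
  then have "coeff (\<theta> (f ^ k) * f) j = coeff (smult (of_nat k) (f ^ k * \<theta> f)) j"
    by (rule arg_cong)
  then show ?thesis by (simp add: coeff_mult coeff_theta)
qed

text \<open>
  Only \<open>f\<^sub>0\<close> and \<open>f\<^sub>p\<close> contribute to the coefficient at \<open>p\<close> in the identity above. The power
  \<open>f\<^sub>0 ^ (k - 1)\<close> is kept in the shape \<open>g\<^sub>0 / f\<^sub>0\<close>.
\<close>

lemma coeff_power_second_lowest:
  fixes f :: "'a::field_char_0 poly"
  assumes "0 < p" and gap: "\<And>i. 0 < i \<Longrightarrow> i < p \<Longrightarrow> coeff f i = 0"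
  shows "coeff f 0 * coeff (f ^ k) p = of_nat k * coeff (f ^ k) 0 * coeff f p"
proof -
  have "(\<Sum>i\<le>p. of_nat i * coeff (f ^ k) i * coeff f (p - i))
      = (\<Sum>i\<in>{p}. of_nat i * coeff (f ^ k) i * coeff f (p - i))"
    by (rule sum.mono_neutral_right) (auto intro!: gap simp: not_less)
  moreover have "(\<Sum>i\<le>p. coeff (f ^ k) i * (of_nat (p - i) * coeff f (p - i)))
      = (\<Sum>i\<in>{0}. coeff (f ^ k) i * (of_nat (p - i) * coeff f (p - i)))"
    by (rule sum.mono_neutral_right) (auto intro!: gap simp: not_less)
  ultimately have "of_nat p * (coeff f 0 * coeff (f ^ k) p)
      = of_nat p * (of_nat k * coeff (f ^ k) 0 * coeff f p)"
    using coeff_power_log_derivative[of f k p] by (simp add: mult_ac)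
  then show ?thesis using \<open>0 < p\<close> by simp
qed

lemma coeff_power_second_lowest_nonzero:
  fixes f :: "'a::field_char_0 poly"
  assumes "0 < p" and "\<And>i. 0 < i \<Longrightarrow> i < p \<Longrightarrow> coeff f i = 0"
    and "coeff f 0 \<noteq> 0" and "coeff f p \<noteq> 0" and "0 < k"
  shows "coeff (f ^ k) p \<noteq> 0"
  using coeff_power_second_lowest[OF assms(1,2), of k] assms(3-5) by (auto simp: coeff_0_power)

text \<open>Reflection exchanges the two ends of a polynomial and commutes with powers.\<close>

lemma coeff_power_second_highest_nonzero:
  fixes f :: "'a::field_char_0 poly"
  assumes "0 < q" and "q \<le> degree f"
    and gap: "\<And>i. 0 < i \<Longrightarrow> i < q \<Longrightarrow> coeff f (degree f - i) = 0"
    and "coeff f (degree f - q) \<noteq> 0" and "0 < k"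
  shows "coeff (f ^ k) (k * degree f - q) \<noteq> 0"
proof -
  have "f \<noteq> 0" using assms(4) by auto
  have "coeff (reflect_poly f ^ k) q \<noteq> 0"
    using assms \<open>f \<noteq> 0\<close>
    by (intro coeff_power_second_lowest_nonzero) (auto simp: coeff_reflect_poly)
  then show ?thesis
    using \<open>f \<noteq> 0\<close>
    by (auto simp: reflect_poly_power[symmetric] coeff_reflect_poly degree_power_eq split: if_splits)
qed

text \<open>
  Where the power looks like a binomial, the base satisfies the recursion of the binomial series
  with exponent \<open>1 / k\<close>.
\<close>

lemma binomial_root_recursion:
  fixes f :: "'a::field_char_0 poly"
  assumes "0 < p" and f0: "coeff f 0 \<noteq> 0" and "0 < k"
    and gap: "\<And>i. 0 < i \<Longrightarrow> i < p \<Longrightarrow> coeff f i = 0"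
    and binomial: "\<And>i. 0 < i \<Longrightarrow> i \<le> j \<Longrightarrow> i \<noteq> p \<Longrightarrow> coeff (f ^ k) i = 0"
    and "p \<le> j"
  shows "of_nat j * coeff f 0 * coeff f j =
    coeff f p * (of_nat p - of_nat k * of_nat (j - p)) * coeff f (j - p)"
proof -
  let ?g = "coeff (f ^ k)"
  have "(\<Sum>i\<le>j. of_nat i * ?g i * coeff f (j - i))
      = (\<Sum>i\<in>{0, p}. of_nat i * ?g i * coeff f (j - i))"
    using \<open>p \<le> j\<close> by (intro sum.mono_neutral_right) (auto intro!: binomial)
  moreover have "(\<Sum>i\<le>j. ?g i * (of_nat (j - i) * coeff f (j - i)))
      = (\<Sum>i\<in>{0, p}. ?g i * (of_nat (j - i) * coeff f (j - i)))"
    using \<open>p \<le> j\<close> by (intro sum.mono_neutral_right) (auto intro!: binomial)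
  ultimately have rec: "of_nat p * ?g p * coeff f (j - p) =
      of_nat k * (?g 0 * (of_nat j * coeff f j) + ?g p * (of_nat (j - p) * coeff f (j - p)))"
    using coeff_power_log_derivative[of f k j] \<open>0 < p\<close> by simp
  have second: "coeff f 0 * ?g p = of_nat k * ?g 0 * coeff f p"
    using \<open>0 < p\<close> gap by (rule coeff_power_second_lowest)
  have "of_nat k * ?g 0 * (of_nat j * coeff f 0 * coeff f j) =
      coeff f 0 * ?g p * (of_nat p - of_nat k * of_nat (j - p)) * coeff f (j - p)"
    using arg_cong[OF rec, of "\<lambda>u. coeff f 0 * u"] by (simp add: algebra_simps)
  also have "\<dots> = of_nat k * ?g 0 *
      (coeff f p * (of_nat p - of_nat k * of_nat (j - p)) * coeff f (j - p))"
    unfolding second by (simp add: mult_ac)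
  finally show ?thesis using f0 \<open>0 < k\<close> by (simp add: coeff_0_power)
qed

section \<open>Polynomials with nonzero constant term\<close>

lemma poly_step_imp_equiv: "poly_step f g \<Longrightarrow> f \<simeq> g"
  unfolding poly_equiv_def by blast

lemma poly_equiv_sym: "f \<simeq> g \<Longrightarrow> g \<simeq> f"
  unfolding poly_equiv_def by (rule equivclp_sym)

lemma poly_equiv_trans [trans]: "f \<simeq> g \<Longrightarrow> g \<simeq> h \<Longrightarrow> f \<simeq> h"
  unfolding poly_equiv_def by (rule equivclp_trans)

text \<open>
  From \<open>1 + x - x\<^sup>2 / 2\<close>, rescale \<open>x\<close> by \<open>b\<close> first and substitute \<open>x ^ p\<close> afterwards; in this
  order no \<open>p\<close>-th root of \<open>b\<close> is called for.
\<close>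

lemma equiv_trinomial:
  fixes f :: "'a::field_char_0 poly"
  assumes "0 < p" and "a \<noteq> 0" and "b \<noteq> 0"
    and f: "f = smult a (1 + monom b p + monom (- (b\<^sup>2 / 2)) (2 * p))"
  shows "f \<simeq> [:1, 1, - (1 / 2):]"
proof -
  let ?h = "[:1, 1, - (1 / 2):] :: 'a poly"
  let ?hb = "pcompose ?h [:0, b:]"
  have square: "monom 1 p * monom c p = monom c (p * 2)" for c :: 'a
    by (simp add: mult_monom mult_2_right)
  have "?hb = [:1, b, - (b\<^sup>2 / 2):]"
    by (simp add: pcompose_pCons power2_eq_square)
  then have "pcompose ?hb (monom 1 p) = 1 + monom b p + monom (- (b\<^sup>2 / 2)) (2 * p)"
    by (simp add: pcompose_pCons algebra_simps square smult_monom one_pCons)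
  then have "f = smult a (pcompose ?hb (monom 1 p))" using f by simp
  moreover have "?h \<simeq> ?hb"
    using \<open>b \<noteq> 0\<close> by (intro poly_step_imp_equiv poly_step_scale)
  moreover have "?hb \<simeq> pcompose ?hb (monom 1 p)"
    using \<open>0 < p\<close> by (intro poly_step_imp_equiv poly_step_power) simp
  moreover have "pcompose ?hb (monom 1 p) \<simeq> smult a (pcompose ?hb (monom 1 p))"
    using \<open>a \<noteq> 0\<close> by (intro poly_step_imp_equiv poly_step_smult)
  ultimately have "?h \<simeq> f" by (metis poly_equiv_trans)
  then show ?thesis by (rule poly_equiv_sym)
qed

text \<open>
  The comparison of exponents: the binomial part of \<open>f ^ k\<close> must end before the recursion can
  propagate the nonzero coefficient at the degree \<open>N\<close> of \<open>f\<close> to \<open>N + p\<close>, which leaves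
  no room beyond \<open>k = 2\<close> and \<open>N = 2 p\<close>.
\<close>

lemma few_terms_power_nonzero_const:
  fixes f :: "'a::field_char_0 poly"
  assumes terms: "3 \<le> num_terms f" and k: "2 \<le> k" and f0: "coeff f 0 \<noteq> 0"
  shows "4 \<le> num_terms (f ^ k) \<and>
    (num_terms (f ^ k) = 4 \<longrightarrow> k = 2 \<and> f \<simeq> [:1, 1, - (1 / 2):])"
proof -
  define N where "N = degree f"
  define p where "p = (LEAST i. 0 < i \<and> coeff f i \<noteq> 0)"
  define q where "q = (LEAST i. 0 < i \<and> coeff f (N - i) \<noteq> 0)"
  have "f \<noteq> 0" using f0 by auto
  have fN: "coeff f N \<noteq> 0" using \<open>f \<noteq> 0\<close> by (simp add: N_def)
  have above_N: "coeff f i = 0" if "N < i" for i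
    using that by (simp add: N_def coeff_eq_0)
  obtain m where m: "0 < m" "m < N" "coeff f m \<noteq> 0"
  proof (rule ccontr)
    assume "\<not> thesis"
    then have "{j. coeff f j \<noteq> 0} \<subseteq> {0, N}"
      using that above_N
      by (metis (mono_tags, lifting) insertCI linorder_neqE_nat mem_Collect_eq neq0_conv subsetI)
    then have "num_terms f \<le> card {0, N}"
      unfolding num_terms_def by (intro card_mono) auto
    also have "\<dots> \<le> 2" by (simp add: card_insert_if)
    finally show False using terms by simp
  qed
  have p: "0 < p" "coeff f p \<noteq> 0"
    using LeastI[of "\<lambda>i. 0 < i \<and> coeff f i \<noteq> 0" m] m by (auto simp: p_def)
  have p_least: "p \<le> i" if "0 < i" "coeff f i \<noteq> 0" for i
    unfolding p_def using that by (intro Least_le) auto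
  have "p < N" using p_least[of m] m by simp
  have q: "0 < q" "coeff f (N - q) \<noteq> 0"
    using LeastI[of "\<lambda>i. 0 < i \<and> coeff f (N - i) \<noteq> 0" N] f0 m by (auto simp: q_def)
  have q_least: "q \<le> i" if "0 < i" "coeff f (N - i) \<noteq> 0" for i
    unfolding q_def using that by (intro Least_le) auto
  have "q \<le> N - p" using q_least[of "N - p"] \<open>p < N\<close> p by simp
  then have "p + q \<le> N" using \<open>p < N\<close> by simp
  have "2 * N \<le> k * N" using k by simp

  let ?g = "coeff (f ^ k)"
  let ?E = "{0, p, k * N - q, k * N}"
  have gap: "coeff f i = 0" if "0 < i" "i < p" for i
    using p_least[of i] that by force
  have gap_top: "coeff f (N - i) = 0" if "0 < i" "i < q" for i
    using q_least[of i] that by force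
  have "?g (k * N - q) \<noteq> 0"
    unfolding N_def
  proof (rule coeff_power_second_highest_nonzero)
    show "q \<le> degree f" "0 < k" using \<open>q \<le> N - p\<close> k by (simp_all add: N_def)
  qed (use q gap_top in \<open>simp_all add: N_def\<close>)
  moreover have "?g p \<noteq> 0"
    using p f0 k gap by (intro coeff_power_second_lowest_nonzero) auto
  moreover have "?g (k * N) \<noteq> 0"
    using fN \<open>f \<noteq> 0\<close> degree_power_eq[of f k] leading_coeff_neq_0[of "f ^ k"]
    by (simp add: N_def)
  ultimately have E_sub: "?E \<subseteq> {j. ?g j \<noteq> 0}"
    using f0 by (auto simp: coeff_0_power)
  have E_card: "card ?E = 4"
  proof -
    have four: "card {a, b, c, d} = 4" if "a < b" "b < c" "c < d" for a b c d :: nat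
      using that by simp
    have "p < k * N - q" "k * N - q < k * N"
      using p(1) q(1) \<open>p < N\<close> \<open>p + q \<le> N\<close> \<open>2 * N \<le> k * N\<close> by linarith+
    then show ?thesis by (rule four[OF p(1)])
  qed
  have fin: "finite {j. ?g j \<noteq> 0}"
    by (rule finite_subset[of _ "{..degree (f ^ k)}"]) (auto intro: le_degree)
  have at_least: "4 \<le> num_terms (f ^ k)"
    using card_mono[OF fin E_sub] E_card by (simp add: num_terms_def)
  moreover have "k = 2 \<and> f \<simeq> [:1, 1, - (1 / 2):]" if "num_terms (f ^ k) = 4"
  proof -
    have supp: "{j. ?g j \<noteq> 0} = ?E"
      using card_subset_eq[OF fin E_sub] that E_card by (simp add: num_terms_def)
    have rec: "of_nat j * coeff f 0 * coeff f j =
        coeff f p * (of_nat p - of_nat k * of_nat (j - p)) * coeff f (j - p)"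
      if "p \<le> j" "j < k * N - q" for j
    proof (rule binomial_root_recursion)
      show "?g i = 0" if "0 < i" "i \<le> j" "i \<noteq> p" for i
      proof -
        have "i \<notin> ?E" using that \<open>j < k * N - q\<close> by auto
        then show ?thesis using supp by blast
      qed
    qed (use p f0 k gap that in auto)

    \<comment> \<open>The factor \<open>p - k N\<close> of the recursion at \<open>N + p\<close> is negative, so it cannot stop there.\<close>
    have "k * N - q \<le> N + p"
    proof (rule ccontr)
      assume "\<not> ?thesis"
      then have "coeff f p * (of_nat p - of_nat k * of_nat N) * coeff f N = 0"
        using rec[of "N + p"] above_N[of "N + p"] p by simp
      then have "of_nat p = (of_nat (k * N) :: 'a)" using p fN by simp
      then have "p = k * N" by (simp only: of_nat_eq_iff)
      then show False using \<open>p < N\<close> \<open>2 * N \<le> k * N\<close> by linarith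
    qed
    \<comment> \<open>Read backwards, the recursion passes from the exponent \<open>N\<close> to \<open>N - p\<close>.\<close>
    have "coeff f (N - p) \<noteq> 0"
    proof -
      have "p \<le> N" "N < k * N - q" "0 < N"
        using p(1) \<open>p < N\<close> \<open>p + q \<le> N\<close> \<open>2 * N \<le> k * N\<close> by linarith+
      then show ?thesis using rec[of N] fN f0 by auto
    qed
    then have "q \<le> p" "p \<le> N - p"
      using q_least[of p] p_least[of "N - p"] p \<open>p < N\<close> by auto
    then have "k * N \<le> 2 * N" "N = 2 * p"
      using \<open>k * N - q \<le> N + p\<close> \<open>2 * N \<le> k * N\<close> by linarith+
    then have "k = 2" using k p by simp
    have "q = p"
      using \<open>k * N - q \<le> N + p\<close> \<open>q \<le> p\<close> p unfolding \<open>N = 2 * p\<close> \<open>k = 2\<close> by linarith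

    define b where "b = coeff f p / coeff f 0"
    have between: "coeff f j = 0" if "p < j" "j < 2 * p" for j
      using rec[of j] gap[of "j - p"] that f0 p unfolding \<open>N = 2 * p\<close> \<open>k = 2\<close> \<open>q = p\<close> by simp
    have "of_nat p * (2 * coeff f 0 * coeff f (2 * p)) = of_nat p * (- (coeff f p)\<^sup>2)"
      using rec[of "2 * p"] p unfolding \<open>N = 2 * p\<close> \<open>k = 2\<close> \<open>q = p\<close>
      by (simp add: algebra_simps power2_eq_square)
    then have "2 * coeff f 0 * coeff f (2 * p) = - (coeff f p)\<^sup>2"
      using p by (simp only: mult_cancel_left of_nat_eq_0_iff) simp
    then have top: "coeff f (2 * p) = coeff f 0 * (- (b\<^sup>2 / 2))"
      using f0 by (simp add: b_def field_simps power2_eq_square)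
    have "f = smult (coeff f 0) (1 + monom b p + monom (- (b\<^sup>2 / 2)) (2 * p))" (is "f = ?r")
    proof (rule poly_eqI)
      fix j
      consider "j = 0" | "0 < j" "j < p" | "j = p" | "p < j" "j < 2 * p" | "j = 2 * p" | "2 * p < j"
        by linarith
      then show "coeff f j = coeff ?r j"
        by cases (use p f0 gap between above_N top \<open>N = 2 * p\<close> in \<open>auto simp: b_def\<close>)
    qed
    then have "f \<simeq> [:1, 1, - (1 / 2):]"
      using p f0 by (intro equiv_trinomial[of p "coeff f 0" b]) (auto simp: b_def)
    with \<open>k = 2\<close> show ?thesis by simp
  qed
  ultimately show ?thesis by simp
qed

section \<open>Removing powers of the variable\<close>

lemma poly_split_power_of_X:
  fixes f :: "'a::field poly"
  assumes "f \<noteq> 0"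
  obtains n h where "f = monom 1 n * h" and "coeff h 0 \<noteq> 0"
proof -
  obtain h where "f = [:- 0, 1:] ^ order 0 f * h" and "\<not> [:- 0, 1:] dvd h"
    using order_decomp[OF assms, of 0] by blast
  then have "f = monom 1 (order 0 f) * h" and "coeff h 0 \<noteq> 0"
    by (simp_all add: monom_altdef dvd_iff_poly_eq_0 poly_0_coeff_0)
  then show ?thesis by (rule that)
qed

lemma num_terms_monom_mult: "num_terms (monom 1 n * h) = num_terms (h :: 'a::field poly)"
proof -
  have "{j. coeff (monom 1 n * h) j \<noteq> 0} = (\<lambda>j. n + j) ` {j. coeff h j \<noteq> 0}"
  proof (intro set_eqI iffI)
    fix j assume "j \<in> {j. coeff (monom 1 n * h) j \<noteq> 0}"
    then have "j = n + (j - n)" "coeff h (j - n) \<noteq> 0"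
      by (auto simp: coeff_monom_mult split: if_splits)
    then show "j \<in> (\<lambda>j. n + j) ` {j. coeff h j \<noteq> 0}" by blast
  qed (auto simp: coeff_monom_mult)
  then show ?thesis unfolding num_terms_def by (simp add: card_image)
qed

text \<open>Both polynomials have the same reflection.\<close>

lemma monom_mult_equiv:
  fixes h :: "'a::field poly"
  assumes "h \<noteq> 0"
  shows "monom 1 n * h \<simeq> h"
proof -
  have "reflect_poly (monom 1 n * h) = reflect_poly h"
    by (simp add: reflect_poly_mult monom_altdef reflect_poly_power reflect_poly_pCons'
        flip: one_pCons)
  moreover have "monom 1 n * h \<simeq> reflect_poly (monom 1 n * h)"
    using assms by (intro poly_step_imp_equiv poly_step_reflect) (simp add: monom_eq_0_iff)
  moreover have "h \<simeq> reflect_poly h"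
    using assms by (intro poly_step_imp_equiv poly_step_reflect)
  ultimately show ?thesis by (metis poly_equiv_sym poly_equiv_trans)
qed

theorem proposition2p3:
  fixes f :: "'a::{alg_closed_field, field_char_0} poly" and k :: nat
  assumes "num_terms f \<ge> 3" and "k \<ge> 2"
  shows "num_terms (f ^ k) \<ge> 4 \<and>
    (num_terms (f ^ k) = 4 \<longrightarrow> k = 2 \<and> f \<simeq> [:1, 1, - (1 / 2):])"
proof -
  have "f \<noteq> 0" using assms(1) by (auto simp: num_terms_def)
  then obtain n h where f: "f = monom 1 n * h" and h0: "coeff h 0 \<noteq> 0"
    by (rule poly_split_power_of_X)
  have "f ^ k = monom 1 (n * k) * h ^ k"
    by (simp add: f power_mult_distrib monom_power)
  then have "num_terms (f ^ k) = num_terms (h ^ k)"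
    by (simp add: num_terms_monom_mult)
  moreover have "num_terms h \<ge> 3"
    using assms(1) by (simp add: f num_terms_monom_mult)
  moreover have "f \<simeq> h"
    using h0 unfolding f by (intro monom_mult_equiv) auto
  ultimately show ?thesis
    using few_terms_power_nonzero_const[OF _ assms(2) h0] poly_equiv_trans by auto
qed

end
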